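(* Let $n\ge1$ be a natural number and let $\rho\in\mathbf{W}_n$. Call a finite set $X=\{t_j\}_{j=1}^m$ with $-1<t_1<t_2<\dots<t_m<1$ admissible if $X\cap[x_n,1]\neq\emptyset$ and $S_k(X\cap[x_{k+1},1])=X\cap[x_k,x_{k+1}]$ for all $k=0,1,\dots,n-1$. Then: (i) every admissible set $X$ satisfies $m=|X|\ge 2^{n-1}$; (ii) if $X$ is admissible and $t_m=x_n$, then $m=|X|=2^{n-1}$ and $\int_{-1}^1P(x)\rho(x)\,dx=\frac1m\sum_{k=1}^mP(t_k)$ for every polynomial $P$ of degree at most $2^n-1$; (iii) consequently, with $m=2^{n-1}$, $$M_m(\rho)=2m-1.$$
   Context: For a nonnegative function $\rho$ on $[-1,1]$ (or $(-1,1)$) and a natural number $m$, $M_m(\rho)$ denotes the biggest natural number $d$ for which there exist distinct points $y_1,\dots,y_m\in[-1,1]$ such that $\int_{-1}^1P(x)\rho(x)\,dx=\frac1m\sum_{k=1}^mP(y_k)$ for every polynomial $P$ of degree at most $d$. Sequence $x_n$: $x_0=-1$ and $x_{n+1}=\sqrt{\frac{1+x_n}{2}}$ for $n=0,1,2,\dots$ (so $x_1=0$; the sequence is increasing with limit $1$). Polynomials $P_{2^p}$: $P_1(x)=x$, $P_2(x)=2x^2-1$, and $P_{2^p}(x)=P_2(P_{2^{p-1}}(x))$ for $p\ge 1$. On $[x_p,1]$ the polynomial $P_{2^p}$ is increasing, with $P_{2^p}(x_p)=-1$, $P_{2^p}(x_{p+1})=0$, $P_{2^p}(1)=1$. Maps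 $S_n$: $S_0:[x_1,1]\to[x_0,x_1]$ is $S_0(x)=-x$. For $n\ge1$, $S_n:[x_{n+1},1]\to[x_n,x_{n+1}]$ is the one-to-one mapping such that $P_{2^n}(x)=-P_{2^n}(S_n(x))$ for $x_{n+1}\le x\le 1$. Class $\mathbf{W}_n$ ($n\ge1$): the family of nonnegative (measurable) functions $\rho$ on $(-1,1)$ such that $\int_{-1}^1\rho(x)\,dx=1$ and, for each $k=0,1,\dots,n-1$, $$\rho(y)=-\rho(S_k(y))\,\frac{dS_k(y)}{dy}\quad\text{for all } x_{k+1}<y<1.$$ *)

theory Defs
  imports "HOL-Analysis.Analysis" "HOL-Computational_Algebra.Polynomial"
begin

definition quad_exact :: "nat \<Rightarrow> (real \<Rightarrow> real) \<Rightarrow> nat \<Rightarrow> bool" where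
  "quad_exact m \<rho> d \<longleftrightarrow>
     (\<exists>y :: nat \<Rightarrow> real. y ` {1..m} \<subseteq> {-1..1} \<and> inj_on y {1..m} \<and>
        (\<forall>P :: real poly. degree P \<le> d \<longrightarrow>
           (LINT x:{-1<..<1}|lebesgue. poly P x * \<rho> x) = 1 / real m * (\<Sum>k=1..m. poly P (y k))))"

(* GREATEST is unspecified if no largest such d exists; for rho nonnegative with integral 1
   and m \<ge> 1, where a node choice exact up to degree 0 always exists and the square of the
   node polynomial (degree 2m) is never integrated exactly, the maximum exists. *)
definition M :: "nat \<Rightarrow> (real \<Rightarrow> real) \<Rightarrow> nat" where
  "M m \<rho> = (GREATEST d. quad_exact m \<rho> d)"

primrec xs :: "nat \<Rightarrow> real" where
  "xs 0 = -1"
| "xs (Suc n) = sqrt ((1 + xs n) / 2)"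

(* Indexed by the exponent: cheb2 p is the polynomial P_{2^p} of degree 2^p. *)
primrec cheb2 :: "nat \<Rightarrow> real poly" where
  "cheb2 0 = [:0, 1:]"
| "cheb2 (Suc p) = pcompose [:-1, 0, 2:] (cheb2 p)"

(* Only meaningful for y in [xs (n+1), 1]. There cheb2 n takes values in [0,1], and it maps
   [xs n, xs (n+1)] bijectively onto [-1,0], so the description is unique. *)
definition S :: "nat \<Rightarrow> real \<Rightarrow> real" where
  "S n y = (if n = 0 then - y
            else (THE z. z \<in> {xs n..xs (Suc n)} \<and> poly (cheb2 n) y = - poly (cheb2 n) z))"

(* Members are total functions, but only their values on (-1,1) matter. *)
definition W :: "nat \<Rightarrow> (real \<Rightarrow> real) set" where
  "W n = {\<rho>. (\<forall>x\<in>{-1<..<1}. 0 \<le> \<rho> x) \<and>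
              set_integrable lebesgue {-1<..<1} \<rho> \<and>
              (LINT x:{-1<..<1}|lebesgue. \<rho> x) = 1 \<and>
              (\<forall>k<n. \<forall>y. xs (Suc k) < y \<and> y < 1 \<longrightarrow> \<rho> y = - \<rho> (S k y) * deriv (S k) y)}"

definition admissible :: "nat \<Rightarrow> real set \<Rightarrow> bool" where
  "admissible n X \<longleftrightarrow>
     finite X \<and> X \<subseteq> {-1<..<1} \<and> X \<inter> {xs n..1} \<noteq> {} \<and>
     (\<forall>k<n. S k ` (X \<inter> {xs (Suc k)..1}) = X \<inter> {xs k..xs (Suc k)})"

end

theory Submission
  imports Defs
begin

text \<open>Put \<open>x = cos t\<close>. Then \<open>xs k\<close> is the angle \<open>pi / 2 ^ k\<close>, \<open>cheb2 k\<close> is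
  \<open>t \<mapsto> cos (2 ^ k * t)\<close>, and \<open>S k\<close> is the reflection \<open>t \<mapsto> pi / 2 ^ k - t\<close>. Write a polynomial
  as \<open>F x = F0 (2 * x\<^sup>2 - 1) + x * F1 (2 * x\<^sup>2 - 1)\<close> and substitute \<open>cheb2 k\<close>: the second summand is
  odd under \<open>S k\<close>, so it disappears from the integral against \<open>\<rho>\<close> and from the sum over an
  admissible set, both taken over \<open>[xs k, 1]\<close>; the first is even, so both reduce to twice the same
  expression for \<open>F0\<close> and \<open>k + 1\<close>, with half the degree. After \<open>n\<close> steps only a constant remains.
  The value \<open>2 * m - 1\<close> cannot be exceeded, because the square of the node polynomial, of degree
  \<open>2 * m\<close>, has a positive integral.\<close>

section \<open>Trigonometric form of \<open>xs\<close>, \<open>cheb2\<close> and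
  \<open>S\<close>\<close>

declare xs.simps(2) [simp del]

text \<open>Half-angle formula. The angle \<open>pi / 2 ^ Suc k\<close> is at most
  \<open>pi / 2\<close>, so its cosine is the nonnegative root that \<open>sqrt\<close>
  selects.\<close>

lemma xs_eq_cos: "xs k = cos (pi / 2 ^ k)"
proof (induction k)
  case (Suc k)
  have "cos (pi / 2 ^ k) = 2 * cos (pi / 2 ^ Suc k) ^ 2 - 1"
    by (simp flip: cos_double_cos)
  moreover have "pi / 2 ^ Suc k \<le> pi / 2"
    by (simp add: divide_simps)
  then have "cos (pi / 2 ^ Suc k) \<ge> 0"
    by (intro cos_ge_zero) (auto intro: order_trans[of _ 0])
  ultimately show ?case
    using Suc by (simp add: xs.simps(2) real_sqrt_unique)
qed simp

lemma xs_atLeastAtMost_cosE: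
  assumes "y \<in> {xs k..1}"
  obtains t where "0 \<le> t" "t \<le> pi / 2 ^ k" "y = cos t"
proof
  have y: "-1 \<le> y" "y \<le> 1"
    using assms cos_ge_minus_one[of "pi / 2 ^ k"] unfolding xs_eq_cos atLeastAtMost_iff by linarith+
  show "0 \<le> arccos y" "y = cos (arccos y)"
    using y by (auto simp: arccos_lbound cos_arccos)
  have "arccos y \<le> arccos (cos (pi / 2 ^ k))"
    using assms by (intro arccos_le_arccos) (auto simp: xs_eq_cos)
  also have "\<dots> = pi / 2 ^ k"
    by (intro arccos_cos) (auto simp: divide_simps)
  finally show "arccos y \<le> pi / 2 ^ k" .
qed

lemma pi_dyadic_le_pi: "pi / 2 ^ k \<le> pi"
  by (simp add: divide_simps)

lemma cos_le_xs_iff: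
  assumes "0 \<le> t" "t \<le> pi"
  shows "cos t \<le> xs k \<longleftrightarrow> pi / 2 ^ k \<le> t"
  unfolding xs_eq_cos using assms by (intro cos_mono_le_eq) (auto simp: pi_dyadic_le_pi)

lemma xs_le_cos_iff:
  assumes "0 \<le> t" "t \<le> pi"
  shows "xs k \<le> cos t \<longleftrightarrow> t \<le> pi / 2 ^ k"
  unfolding xs_eq_cos using assms by (intro cos_mono_le_eq) (auto simp: pi_dyadic_le_pi)

lemma xs_less_Suc: "xs k < xs (Suc k)"
  unfolding xs_eq_cos by (intro cos_monotone_0_pi) (auto simp: divide_simps)

lemma xs_less_1: "xs k < 1"
  using cos_monotone_0_pi[of 0 "pi / 2 ^ k"] by (simp add: xs_eq_cos pi_dyadic_le_pi)

lemma xs_ge_minus_1: "-1 \<le> xs k"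
  by (simp add: xs_eq_cos)

lemma poly_cheb2_Suc: "poly (cheb2 (Suc k)) x = 2 * poly (cheb2 k) x ^ 2 - 1"
  by (simp add: poly_pcompose power2_eq_square algebra_simps)

lemma poly_cheb2_cos: "poly (cheb2 k) (cos t) = cos (2 ^ k * t)"
proof (induction k)
  case (Suc k)
  have "cos (2 ^ Suc k * t) = 2 * cos (2 ^ k * t) ^ 2 - 1"
    using cos_double_cos[of "2 ^ k * t"] by (simp add: mult.assoc)
  with Suc show ?case by (simp only: poly_cheb2_Suc)
qed simp

text \<open>Reflecting the angle replaces \<open>2 ^ k * t\<close> by \<open>pi - 2 ^ k * t\<close>
  and so negates \<open>cheb2 k\<close>. This removes the definite description from all later
  arguments.\<close>

lemma S_cos:
  assumes "0 \<le> t" "t \<le> pi / 2 ^ Suc k"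
  shows "S k (cos t) = cos (pi / 2 ^ k - t)"
proof (cases "k = 0")
  case True
  then show ?thesis by (simp add: S_def cos_diff)
next
  case False
  define u where "u = pi / 2 ^ k - t"
  have u: "pi / 2 ^ Suc k \<le> u" "u \<le> pi / 2 ^ k"
    using assms by (auto simp: u_def)
  have u0: "0 \<le> u" "u \<le> pi"
    using u pi_dyadic_le_pi[of k] by (auto intro: order_trans[of _ "pi / 2 ^ Suc k"])
  have eq: "cos (2 ^ k * t) = - cos (2 ^ k * u)"
    by (simp add: u_def right_diff_distrib cos_diff)
  have "(THE z. z \<in> {xs k..xs (Suc k)} \<and> poly (cheb2 k) (cos t) = - poly (cheb2 k) z) = cos u"
  proof (rule the_equality)
    show "cos u \<in> {xs k..xs (Suc k)} \<and> poly (cheb2 k) (cos t) = - poly (cheb2 k) (cos u)"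
      using u u0 eq by (simp only: atLeastAtMost_iff cos_le_xs_iff xs_le_cos_iff poly_cheb2_cos)
  next
    fix z assume z: "z \<in> {xs k..xs (Suc k)} \<and> poly (cheb2 k) (cos t) = - poly (cheb2 k) z"
    then obtain v where v: "0 \<le> v" "v \<le> pi / 2 ^ k" "z = cos v"
      using xs_less_1[of "Suc k"] by (rule_tac xs_atLeastAtMost_cosE[of z k]) auto
    have "cos (2 ^ k * v) = cos (2 ^ k * u)"
      using z eq by (simp add: v poly_cheb2_cos)
    \<comment> \<open>Multiplication by \<open>2 ^ k\<close> takes these angles into the interval
      from 0 to \<open>pi\<close>, where cosine is injective; hence the description has only one
      solution.\<close>
    moreover have range: "0 \<le> 2 ^ k * w \<and> 2 ^ k * w \<le> pi" if "0 \<le> w" "w \<le> pi / 2 ^ k" for w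
      using that by (simp add: field_simps)
    ultimately have "2 ^ k * v = 2 ^ k * u"
      using range[OF v(1,2)] range[OF u0(1) u(2)] cos_inj_pi[of "2 ^ k * v" "2 ^ k * u"] by blast
    then show "z = cos u" by (simp add: v)
  qed
  with False show ?thesis by (simp add: S_def u_def)
qed

text \<open>By the recursion, \<open>cheb2 (Suc k)\<close> depends only on the square of
  \<open>cheb2 k\<close>, so a change of sign is invisible to it.\<close>

lemma poly_cheb2_S:
  assumes "y \<in> {xs (Suc k)..1}"
  shows "poly (cheb2 k) (S k y) = - poly (cheb2 k) y"
    and "poly (cheb2 (Suc k)) (S k y) = poly (cheb2 (Suc k)) y"
proof -
  obtain t where t: "0 \<le> t" "t \<le> pi / 2 ^ Suc k" "y = cos t"
    using assms by (rule xs_atLeastAtMost_cosE)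
  show "poly (cheb2 k) (S k y) = - poly (cheb2 k) y"
    unfolding t(3) S_cos[OF t(1,2)] poly_cheb2_cos by (simp add: right_diff_distrib cos_diff)
  then show "poly (cheb2 (Suc k)) (S k y) = poly (cheb2 (Suc k)) y"
    by (simp only: poly_cheb2_Suc) simp
qed

lemma inj_on_S: "inj_on (S k) {xs (Suc k)..1}"
proof (rule inj_onI)
  fix y z assume yz: "y \<in> {xs (Suc k)..1}" "z \<in> {xs (Suc k)..1}" "S k y = S k z"
  obtain t where t: "0 \<le> t" "t \<le> pi / 2 ^ Suc k" "y = cos t"
    using yz(1) by (rule xs_atLeastAtMost_cosE)
  obtain u where u: "0 \<le> u" "u \<le> pi / 2 ^ Suc k" "z = cos u"
    using yz(2) by (rule xs_atLeastAtMost_cosE)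
  have "pi / 2 ^ Suc k \<le> pi / 2 ^ k" by (simp add: divide_simps)
  moreover have "cos (pi / 2 ^ k - t) = cos (pi / 2 ^ k - u)"
    using yz(3) unfolding t(3) u(3) S_cos[OF t(1,2)] S_cos[OF u(1,2)] .
  ultimately have "pi / 2 ^ k - t = pi / 2 ^ k - u"
    using t(1,2) u(1,2) pi_dyadic_le_pi[of k] by (rule_tac cos_inj_pi) linarith+
  then show "y = z" by (simp add: t u)
qed

lemma S_image_open: "S k ` {xs (Suc k)<..<1} = {xs k<..<xs (Suc k)}"
proof (intro equalityI subsetI)
  have half: "pi / 2 ^ k = 2 * (pi / 2 ^ Suc k)" by simp
  fix z
  {
    assume "z \<in> S k ` {xs (Suc k)<..<1}"
    then obtain y where y: "xs (Suc k) < y" "y < 1" "z = S k y" by auto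
    then obtain t where t: "0 \<le> t" "t \<le> pi / 2 ^ Suc k" "y = cos t"
      by (rule_tac xs_atLeastAtMost_cosE[of y "Suc k"]) auto
    have "t \<noteq> 0" "t \<noteq> pi / 2 ^ Suc k"
      using y t by (auto simp only: xs_eq_cos cos_zero)
    then have "0 < t" "t < pi / 2 ^ Suc k" using t by auto
    then show "z \<in> {xs k<..<xs (Suc k)}"
      using t half pi_dyadic_le_pi[of k] cos_monotone_0_pi[of "pi / 2 ^ k - t" "pi / 2 ^ k"]
        cos_monotone_0_pi[of "pi / 2 ^ Suc k" "pi / 2 ^ k - t"]
      by (simp add: y(3) t(3) S_cos[OF t(1,2)] xs_eq_cos)
  }
  assume z: "z \<in> {xs k<..<xs (Suc k)}"
  then obtain u where u: "0 \<le> u" "u \<le> pi / 2 ^ k" "z = cos u"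
    using xs_less_1[of "Suc k"] by (rule_tac xs_atLeastAtMost_cosE[of z k]) auto
  have "\<not> u \<le> pi / 2 ^ Suc k"
    using z u xs_le_cos_iff[of u "Suc k"] pi_dyadic_le_pi[of k] by simp
  moreover have "u \<noteq> pi / 2 ^ k"
    using z u by (auto simp only: xs_eq_cos greaterThanLessThan_iff)
  ultimately have u_bounds: "pi / 2 ^ Suc k < u" "u < pi / 2 ^ k"
    using u by auto
  then have t: "0 < pi / 2 ^ k - u" "pi / 2 ^ k - u < pi / 2 ^ Suc k"
    using u_bounds half by linarith+
  have "z = S k (cos (pi / 2 ^ k - u))"
    using t u by (subst S_cos) auto
  moreover have "cos (pi / 2 ^ k - u) \<in> {xs (Suc k)<..<1}"
    using t pi_dyadic_le_pi[of "Suc k"] cos_monotone_0_pi[of 0 "pi / 2 ^ k - u"]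
    unfolding greaterThanLessThan_iff xs_eq_cos
    by (intro conjI cos_monotone_0_pi) auto
  ultimately show "z \<in> S k ` {xs (Suc k)<..<1}" by blast
qed

section \<open>Folding the integral against \<open>\<rho>\<close>\<close>

text \<open>On the open interval \<open>S k\<close> agrees with the explicit function
  \<open>g\<close>, and \<open>arccos\<close> is differentiable strictly between -1 and 1. The angle
  of the image lies between 0 and \<open>pi\<close>, where sine is nonnegative; this gives the
  sign.\<close>

lemma S_DERIV:
  assumes y: "y \<in> {xs (Suc k)<..<1}"
  shows "(S k has_field_derivative deriv (S k) y) (at y)" "deriv (S k) y \<le> 0"
proof -
  define g where "g = (\<lambda>y. cos (pi / 2 ^ k - arccos y))"
  define D where "D = - sin (pi / 2 ^ k - arccos y) / sqrt (1 - y\<^sup>2)"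
  have y1: "-1 < y" "y < 1"
    using y xs_ge_minus_1[of "Suc k"] by auto
  have "(g has_field_derivative D) (at y)"
    unfolding g_def D_def using y1
    by (auto intro!: derivative_eq_intros simp: divide_simps)
  moreover have S_eq: "S k z = g z" if zk: "z \<in> {xs (Suc k)<..<1}" for z
  proof -
    obtain t where t: "0 \<le> t" "t \<le> pi / 2 ^ Suc k" "z = cos t"
      using zk by (rule_tac xs_atLeastAtMost_cosE[of z "Suc k"]) auto
    then show ?thesis
      using pi_dyadic_le_pi[of "Suc k"] by (simp only: S_cos g_def) (simp add: arccos_cos)
  qed
  ultimately have der: "(S k has_field_derivative D) (at y)"
    using y by (elim has_field_derivative_transform_within_open[where S = "{xs (Suc k)<..<1}"]) auto
  then have D: "deriv (S k) y = D" by (rule DERIV_imp_deriv)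
  with der show "(S k has_field_derivative deriv (S k) y) (at y)" by simp
  obtain t where t: "0 \<le> t" "t \<le> pi / 2 ^ Suc k" "y = cos t"
    using y by (rule_tac xs_atLeastAtMost_cosE[of y "Suc k"]) auto
  have "arccos y = t" 
    using t pi_dyadic_le_pi[of "Suc k"] by (simp add: arccos_cos)
  moreover have "sin (pi / 2 ^ k - t) \<ge> 0"
    using t pi_dyadic_le_pi[of k] by (intro sin_ge_zero) simp_all
  moreover have "y\<^sup>2 \<le> 1" using y1 by (simp add: abs_square_le_1)
  ultimately show "deriv (S k) y \<le> 0"
    by (simp add: D D_def)
qed

text \<open>Split at \<open>xs (Suc k)\<close> and substitute \<open>S k\<close> on the left part.
  The relation in \<open>W\<close> says that this substitution, Jacobian included, carries
  \<open>\<rho>\<close> to itself.\<close>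

lemma integral_xs_fold:
  fixes f :: "real \<Rightarrow> real"
  assumes \<rho>: "\<rho> \<in> W n" and k: "k < n" and f: "continuous_on UNIV f"
  shows "(LINT x:{xs k<..<1}|lebesgue. f x * \<rho> x)
       = (LINT x:{xs (Suc k)<..<1}|lebesgue. (f x + f (S k x)) * \<rho> x)"
proof -
  let ?A = "{xs (Suc k)<..<1}" and ?B = "{xs k<..<xs (Suc k)}"
  have \<rho>_int: "\<rho> absolutely_integrable_on {-1<..<1}"
    and \<rho>_S: "\<And>y. xs (Suc k) < y \<Longrightarrow> y < 1 \<Longrightarrow> \<rho> y = - \<rho> (S k y) * deriv (S k) y"
    using \<rho> k unfolding W_def by blast+
  have f\<rho>: "(\<lambda>x. f x * \<rho> x) absolutely_integrable_on T"
    if "T \<in> sets lebesgue" "T \<subseteq> {-1<..<1}" for T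
  proof (rule absolutely_integrable_bounded_measurable_product_real)
    show "f \<in> borel_measurable (lebesgue_on T)"
      by (intro continuous_imp_measurable_on_sets_lebesgue continuous_on_subset[OF f] that) auto
    have "bounded (f ` {-1..1})"
      by (intro compact_imp_bounded compact_continuous_image continuous_on_subset[OF f]) auto
    then show "bounded (f ` T)"
      using that by (rule_tac bounded_subset) force+
    show "\<rho> absolutely_integrable_on T"
      using \<rho>_int that by (rule set_integrable_subset)
  qed (use that in auto)
  have fA: "(\<lambda>x. f x * \<rho> x) absolutely_integrable_on ?A"
    and fB: "(\<lambda>x. f x * \<rho> x) absolutely_integrable_on ?B"
    using xs_ge_minus_1[of k] xs_ge_minus_1[of "Suc k"] xs_less_1[of "Suc k"]
    by (auto intro!: f\<rho>)
  \<comment> \<open>As the derivative is nonpositive, its absolute value is the factor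
    \<open>- deriv (S k) x\<close> from \<open>W\<close>.\<close>
  have rho: "\<bar>deriv (S k) x\<bar> * (f (S k x) * \<rho> (S k x)) = f (S k x) * \<rho> x" if "x \<in> ?A" for x
    using \<rho>_S[of x] that S_DERIV(2)[OF that] by simp
  \<comment> \<open>This is the right-hand side of the change-of-variables equivalence, which
    transfers integrability and value together.\<close>
  have chg: "(\<lambda>x. f x * \<rho> x) absolutely_integrable_on S k ` ?A \<and>
      integral (S k ` ?A) (\<lambda>x. f x * \<rho> x) = integral ?B (\<lambda>x. f x * \<rho> x)"
    using fB by (simp add: S_image_open)
  have "(\<lambda>x. \<bar>deriv (S k) x\<bar> * (f (S k x) * \<rho> (S k x))) absolutely_integrable_on ?A \<and>
      integral ?A (\<lambda>x. \<bar>deriv (S k) x\<bar> * (f (S k x) * \<rho> (S k x))) = integral ?B (\<lambda>x. f x * \<rho> x)"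
    by (subst has_absolute_integral_change_of_variables_1')
      (use chg in \<open>auto intro: has_field_derivative_at_within[OF S_DERIV(1)]
        inj_on_subset[OF inj_on_S]\<close>)
  moreover have "(\<lambda>x. \<bar>deriv (S k) x\<bar> * (f (S k x) * \<rho> (S k x))) absolutely_integrable_on ?A
      \<longleftrightarrow> (\<lambda>x. f (S k x) * \<rho> x) absolutely_integrable_on ?A"
    by (intro set_integrable_cong rho) auto
  moreover have "integral ?A (\<lambda>x. \<bar>deriv (S k) x\<bar> * (f (S k x) * \<rho> (S k x)))
      = integral ?A (\<lambda>x. f (S k x) * \<rho> x)"
    by (intro Henstock_Kurzweil_Integration.integral_cong rho)
  ultimately have "(\<lambda>x. f (S k x) * \<rho> x) absolutely_integrable_on ?A"
    and "integral ?A (\<lambda>x. f (S k x) * \<rho> x) = integral ?B (\<lambda>x. f x * \<rho> x)"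
    by simp_all
  then have gA: "(\<lambda>x. f (S k x) * \<rho> x) absolutely_integrable_on ?A"
    and eq: "(LINT x:?A|lebesgue. f (S k x) * \<rho> x) = (LINT x:?B|lebesgue. f x * \<rho> x)"
    using fB by (simp_all add: set_lebesgue_integral_eq_integral)
  \<comment> \<open>The split point lies in neither open part, but it is a null set.\<close>
  have "AE x in lebesgue. x \<noteq> xs (Suc k)"
    by (intro AE_completion AE_lborel_singleton)
  then have "(LINT x:{xs k<..<1}|lebesgue. f x * \<rho> x) = (LINT x:?B \<union> ?A|lebesgue. f x * \<rho> x)"
  proof (intro set_integral_cong_set)
    have "?B \<union> ?A \<subseteq> {-1<..<1}"
      using xs_ge_minus_1[of k] xs_ge_minus_1[of "Suc k"] xs_less_1[of "Suc k"] by auto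
    then show "set_borel_measurable lebesgue (?B \<union> ?A) (\<lambda>x. f x * \<rho> x)"
      using f\<rho>[of "?B \<union> ?A"]
      unfolding set_integrable_def set_borel_measurable_def by (intro borel_measurable_integrable) auto
    have "{xs k<..<1} \<subseteq> {-1<..<1}"
      using xs_ge_minus_1[of k] by auto
    then show "set_borel_measurable lebesgue {xs k<..<1} (\<lambda>x. f x * \<rho> x)"
      using f\<rho>[of "{xs k<..<1}"]
      unfolding set_integrable_def set_borel_measurable_def by (intro borel_measurable_integrable) auto
    show "AE x in lebesgue. (x \<in> ?B \<union> ?A) = (x \<in> {xs k<..<1})"
      using \<open>AE x in lebesgue. x \<noteq> xs (Suc k)\<close>
      by eventually_elim (use xs_less_1[of "Suc k"] xs_less_Suc[of k] in auto)
  qed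
  also have "\<dots> = (LINT x:?B|lebesgue. f x * \<rho> x) + (LINT x:?A|lebesgue. f x * \<rho> x)"
    using fA fB by (intro set_integral_Un) auto
  also have "\<dots> = (LINT x:?A|lebesgue. (f x + f (S k x)) * \<rho> x)"
    using fA gA eq by (simp add: distrib_right set_integral_add)
  finally show ?thesis .
qed


text \<open>Folding the constant 1 doubles the integrand, so each level carries half the mass of the
  one before.\<close>

lemma integral_xs:
  assumes "\<rho> \<in> W n" "k \<le> n"
  shows "2 ^ k * (LINT x:{xs k<..<1}|lebesgue. \<rho> x) = 1"
  using assms(2)
proof (induction k)
  case 0
  then show ?case using assms(1) by (simp add: W_def)
next
  case (Suc k)
  then show ?case
    using integral_xs_fold[OF assms(1), of k "\<lambda>_. 1"] by simp
qed

section \<open>Even and odd parts of a polynomial, composed with \<open>cheb2\<close>\<close>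

text \<open>The square is expressed through \<open>u = 2 * x\<^sup>2 - 1\<close> so that
  substituting \<open>cheb2 k\<close> for \<open>x\<close> turns \<open>u\<close> into
  \<open>cheb2 (Suc k)\<close>. In the induction, multiplication by \<open>x\<close> makes the even
  part odd, and the odd part even with a factor \<open>x\<^sup>2\<close>.\<close>

lemma poly_even_odd_split:
  fixes F :: "real poly"
  obtains F0 F1 where "2 * degree F0 \<le> degree F"
    "\<And>x. poly F x = poly F0 (2 * x\<^sup>2 - 1) + x * poly F1 (2 * x\<^sup>2 - 1)"
proof -
  \<comment> \<open>The bound on \<open>F1\<close> serves the induction, where \<open>F1\<close>
    enters the next even part. The zero polynomial has degree 0 and would violate it, hence the
    disjunction.\<close>
  have "\<exists>F0 F1. 2 * degree F0 \<le> degree F \<and> (F1 = 0 \<or> 2 * degree F1 + 1 \<le> degree F) \<and>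
      (\<forall>x. poly F x = poly F0 (2 * x\<^sup>2 - 1) + x * poly F1 (2 * x\<^sup>2 - 1))"
  proof (induction F rule: pCons_induct)
    case 0
    show ?case by (intro exI[of _ 0]) simp
  next
    case (pCons a F)
    then obtain F0 F1 where deg: "2 * degree F0 \<le> degree F" "F1 = 0 \<or> 2 * degree F1 + 1 \<le> degree F"
      and eq: "\<And>x. poly F x = poly F0 (2 * x\<^sup>2 - 1) + x * poly F1 (2 * x\<^sup>2 - 1)"
      by blast
    show ?case
    \<comment> \<open>For \<open>F = 0\<close>, prepending \<open>a\<close> leaves the degree at 0
      instead of raising it by one, as the estimates of the other case require.\<close>
    proof (cases "F = 0")
      case True
      then show ?thesis
        by (intro exI[of _ "[:a:]"] exI[of _ 0]) simp
    next
      case False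
      \<comment> \<open>The factor \<open>[:1/2, 1/2:]\<close> is \<open>(1 + u) / 2\<close>, that
        is, \<open>x\<^sup>2\<close> in terms of \<open>u\<close>.\<close>
      have "degree ([:a:] + [:1/2, 1/2:] * F1) \<le> max 0 (degree ([:1/2, 1/2:] * F1))"
        by (metis degree_add_le_max degree_pCons_0)
      also have "2 * \<dots> \<le> degree (pCons a F)"
      proof (cases "F1 = 0")
        case F1: False
        have "degree ([:1/2, 1/2:] * F1) \<le> 1 + degree F1"
          using degree_mult_le[of "[:1/2, 1/2:]" F1] by simp
        with F1 deg(2) show ?thesis using \<open>F \<noteq> 0\<close> by simp
      qed simp
      finally have "2 * degree ([:a:] + [:1/2, 1/2:] * F1) \<le> degree (pCons a F)"
        by simp
      moreover have "2 * degree F0 + 1 \<le> degree (pCons a F)"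
        using deg(1) False by simp
      moreover have "poly (pCons a F) x = poly ([:a:] + [:1/2, 1/2:] * F1) (2 * x\<^sup>2 - 1)
          + x * poly F0 (2 * x\<^sup>2 - 1)" for x
        by (simp add: eq power2_eq_square field_simps)
      ultimately show ?thesis by blast
    qed
  qed
  then show thesis using that by blast
qed

lemma poly_cheb2_split:
  assumes "\<And>x. poly F x = poly F0 (2 * x\<^sup>2 - 1) + x * poly F1 (2 * x\<^sup>2 - 1)"
  shows "poly F (poly (cheb2 k) x)
       = poly F0 (poly (cheb2 (Suc k)) x) + poly (cheb2 k) x * poly F1 (poly (cheb2 (Suc k)) x)"
  unfolding assms[of "poly (cheb2 k) x"] poly_cheb2_Suc ..

text \<open>\<open>S k\<close> negates the factor \<open>cheb2 k\<close> of the odd summand and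
  preserves \<open>cheb2 (Suc k)\<close>: the odd summands cancel, the even ones coincide.\<close>

lemma poly_cheb2_fold:
  assumes "\<And>x. poly F x = poly F0 (2 * x\<^sup>2 - 1) + x * poly F1 (2 * x\<^sup>2 - 1)"
    and "x \<in> {xs (Suc k)..1}"
  shows "poly F (poly (cheb2 k) x) + poly F (poly (cheb2 k) (S k x))
       = 2 * poly F0 (poly (cheb2 (Suc k)) x)"
  unfolding poly_cheb2_split[OF assms(1), where x = x] poly_cheb2_split[OF assms(1), where x = "S k x"]
  unfolding poly_cheb2_S[OF assms(2)] by simp

lemma integral_poly_cheb2_fold:
  assumes "\<rho> \<in> W n" "k < n"
    and F: "\<And>x. poly F x = poly F0 (2 * x\<^sup>2 - 1) + x * poly F1 (2 * x\<^sup>2 - 1)"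
  shows "(LINT x:{xs k<..<1}|lebesgue. poly F (poly (cheb2 k) x) * \<rho> x)
       = 2 * (LINT x:{xs (Suc k)<..<1}|lebesgue. poly F0 (poly (cheb2 (Suc k)) x) * \<rho> x)"
proof -
  have "(LINT x:{xs k<..<1}|lebesgue. poly F (poly (cheb2 k) x) * \<rho> x)
      = (LINT x:{xs (Suc k)<..<1}|lebesgue.
          (poly F (poly (cheb2 k) x) + poly F (poly (cheb2 k) (S k x))) * \<rho> x)"
    by (intro integral_xs_fold[OF assms(1,2)] continuous_intros)
  also have "\<dots> = (LINT x:{xs (Suc k)<..<1}|lebesgue.
      2 * (poly F0 (poly (cheb2 (Suc k)) x) * \<rho> x))"
  proof (intro set_lebesgue_integral_cong allI impI)
    fix x assume "x \<in> {xs (Suc k)<..<1}"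
    then show "(poly F (poly (cheb2 k) x) + poly F (poly (cheb2 k) (S k x))) * \<rho> x
        = 2 * (poly F0 (poly (cheb2 (Suc k)) x) * \<rho> x)"
      by (subst poly_cheb2_fold[OF F]) auto
  qed simp
  finally show ?thesis by simp
qed

section \<open>Structure of admissible sets\<close>

text \<open>On its interval \<open>S (Suc k)\<close> takes the value \<open>xs (Suc k)\<close> only
  at 1, a point that admissible sets avoid. The bound on \<open>k\<close> leaves out
  \<open>xs n\<close>, which may be a node.\<close>

lemma xs_Suc_notin_admissible:
  assumes X: "admissible n X" and k: "Suc k < n"
  shows "xs (Suc k) \<notin> X"
proof
  assume "xs (Suc k) \<in> X"
  then have "xs (Suc k) \<in> S (Suc k) ` (X \<inter> {xs (Suc (Suc k))..1})"
    using X k xs_less_Suc[of "Suc k"] by (auto simp: admissible_def)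
  then obtain y where y: "y \<in> X" "y \<in> {xs (Suc (Suc k))..1}" "S (Suc k) y = xs (Suc k)"
    by auto
  moreover have "S (Suc k) 1 = xs (Suc k)"
    using S_cos[of 0 "Suc k"] by (simp add: xs_eq_cos)
  ultimately have "y = 1"
    using inj_onD[OF inj_on_S[of "Suc k"], of y 1] xs_less_1[of "Suc (Suc k)"] by auto
  with y(1) X show False by (auto simp: admissible_def)
qed

text \<open>Discrete counterpart of \<open>integral_xs_fold\<close>, ending one level earlier: for
  \<open>Suc k = n\<close> the two pieces may share \<open>xs n\<close>, which would then be counted
  twice.\<close>

lemma sum_admissible_fold:
  fixes f :: "real \<Rightarrow> 'a :: comm_monoid_add"
  assumes X: "admissible n X" and k: "Suc k < n"
  shows "(\<Sum>t\<in>X \<inter> {xs k..1}. f t) = (\<Sum>t\<in>X \<inter> {xs (Suc k)..1}. f t + f (S k t))"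
proof -
  let ?A = "X \<inter> {xs (Suc k)..1}" and ?B = "X \<inter> {xs k..xs (Suc k)}"
  have fin: "finite X" and SA: "S k ` ?A = ?B"
    using X k by (auto simp: admissible_def)
  have "X \<inter> {xs k..1} = ?A \<union> ?B"
    using xs_less_Suc[of k] xs_less_1[of "Suc k"] by auto
  moreover have "?A \<inter> ?B = {}"
    using xs_Suc_notin_admissible[OF assms] by force
  ultimately have "(\<Sum>t\<in>X \<inter> {xs k..1}. f t) = sum f ?A + sum f (S k ` ?A)"
    using fin unfolding SA by (simp add: sum.union_disjoint)
  also have "sum f (S k ` ?A) = (\<Sum>t\<in>?A. f (S k t))"
    by (subst sum.reindex) (auto intro: inj_on_subset[OF inj_on_S])
  finally show ?thesis by (simp add: sum.distrib)
qed

text \<open>With summand 1, each of the \<open>n - 1\<close> folds halves the count.\<close>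

lemma card_admissible:
  assumes X: "admissible n X" and n: "n \<ge> 1"
  shows "card X = 2 ^ (n - 1) * card (X \<inter> {xs (n - 1)..1})"
proof -
  have "card (X \<inter> {xs k..1}) = 2 ^ (n - 1 - k) * card (X \<inter> {xs (n - 1)..1})" if "k \<le> n - 1" for k
    using that
  proof (induction rule: inc_induct)
    case (step k)
    have "card (X \<inter> {xs k..1}) = 2 * card (X \<inter> {xs (Suc k)..1})"
      using sum_admissible_fold[OF X, of k "\<lambda>_. 1::nat"] step.hyps by simp
    also have "\<dots> = 2 ^ Suc (n - 1 - Suc k) * card (X \<inter> {xs (n - 1)..1})"
      using step.IH by simp
    also have "Suc (n - 1 - Suc k) = n - 1 - k"
      using step.hyps by simp
    finally show ?case .
  qed simp
  moreover have "X \<inter> {xs 0..1} = X"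
    using X by (auto simp: admissible_def)
  ultimately show ?thesis
    by (metis diff_zero zero_le)
qed

lemma admissible_last_nonempty:
  assumes X: "admissible n X" and n: "n \<ge> 1"
  shows "X \<inter> {xs (n - 1)..1} \<noteq> {}"
proof -
  have "xs (n - 1) < xs n"
    using xs_less_Suc[of "n - 1"] n by simp
  then show ?thesis using X by (force simp: admissible_def)
qed

text \<open>No node exceeds \<open>xs n\<close>, and \<open>S (n - 1)\<close> fixes
  \<open>xs n\<close>, because its angle \<open>pi / 2 ^ n\<close> is half of
  \<open>pi / 2 ^ (n - 1)\<close>.\<close>

lemma admissible_last_eq:
  assumes X: "admissible n X" and n: "n \<ge> 1" and max: "Max X = xs n"
  shows "X \<inter> {xs (n - 1)..1} = {xs n}"
proof -
  have fin: "finite X" "X \<noteq> {}" using X by (auto simp: admissible_def)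
  then have in_X: "xs n \<in> X" and le: "\<And>x. x \<in> X \<Longrightarrow> x \<le> xs n"
    using Max_in[of X] Max_ge[of X] max by auto
  have top: "X \<inter> {xs n..1} = {xs n}"
    using in_X le xs_less_1[of n] by (force intro: antisym)
  have "X \<inter> {xs (n - 1)..1} = X \<inter> {xs (n - 1)..xs n}"
    using le xs_less_1[of n] by force
  also have "\<dots> = S (n - 1) ` (X \<inter> {xs n..1})"
    using X n unfolding admissible_def by (auto dest!: spec[of _ "n - 1"])
  also have "\<dots> = {S (n - 1) (xs n)}"
    by (simp add: top)
  also have "S (n - 1) (xs n) = xs n"
    using S_cos[of "pi / 2 ^ n" "n - 1"] n by (cases n) (simp_all add: xs_eq_cos)
  finally show ?thesis .
qed

section \<open>The quadrature formula\<close>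

text \<open>The integral is folded \<open>n\<close> times but the sum only \<open>n - 1\<close>
  times: the single node left, \<open>xs n\<close>, is a zero of \<open>cheb2 (n - 1)\<close>, so
  the odd part drops out of the sum without any pairing.\<close>

lemma quadrature_admissible:
  fixes P :: "real poly"
  assumes X: "admissible n X" and n: "n \<ge> 1" and max: "Max X = xs n" and \<rho>: "\<rho> \<in> W n"
    and P: "degree P < 2 ^ n"
  shows "card X = 2 ^ (n - 1)"
    and "(LINT x:{-1<..<1}|lebesgue. poly P x * \<rho> x) = 1 / real (card X) * (\<Sum>t\<in>X. poly P t)"
proof -
  have last: "X \<inter> {xs (n - 1)..1} = {xs n}"
    using X n max by (rule admissible_last_eq)
  show card: "card X = 2 ^ (n - 1)"
    using card_admissible[OF X n] last by simp
  \<comment> \<open>The factor \<open>2 ^ (n - 1)\<close> is \<open>card X\<close> and stays the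
    same at all levels, because both sides double in passing from \<open>Suc k\<close> to
    \<open>k\<close>.\<close>
  have fold: "2 ^ (n - 1) * (LINT x:{xs k<..<1}|lebesgue. poly F (poly (cheb2 k) x) * \<rho> x)
      = (\<Sum>t\<in>X \<inter> {xs k..1}. poly F (poly (cheb2 k) t))"
    if "k \<le> n - 1" "degree F < 2 ^ (n - k)" for k and F :: "real poly"
    using that
  proof (induction arbitrary: F rule: inc_induct)
    case (base F)
    obtain F0 F1 :: "real poly" where F0: "2 * degree F0 \<le> degree F"
      and F: "\<And>x. poly F x = poly F0 (2 * x\<^sup>2 - 1) + x * poly F1 (2 * x\<^sup>2 - 1)"
      using poly_even_odd_split[of F] by auto

    \<comment> \<open>At level \<open>n - 1\<close> the degree of \<open>F\<close> is at most 1, so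
      halving leaves a constant.\<close>
    have "degree F0 = 0" using F0 base n by simp
    then obtain c where c: "F0 = [:c:]" by (rule degree_eq_zeroE)
    have "poly (cheb2 (n - 1)) (xs n) = 0"
      using n by (cases n) (simp_all add: xs_eq_cos poly_cheb2_cos)
    then have "(\<Sum>t\<in>X \<inter> {xs (n - 1)..1}. poly F (poly (cheb2 (n - 1)) t)) = c"
      unfolding last by (simp add: F c)
    moreover have "(LINT x:{xs (n - 1)<..<1}|lebesgue. poly F (poly (cheb2 (n - 1)) x) * \<rho> x)
        = 2 * (c * (LINT x:{xs n<..<1}|lebesgue. \<rho> x))"
      using integral_poly_cheb2_fold[OF \<rho> _ F, of "n - 1"] n by (simp add: c)
    moreover have "2 ^ (n - 1) * (2 * (c * (LINT x:{xs n<..<1}|lebesgue. \<rho> x))) 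
        = c * (2 ^ n * (LINT x:{xs n<..<1}|lebesgue. \<rho> x))"
      using n by (cases n) simp_all
    ultimately show ?case
      using integral_xs[OF \<rho> order_refl] by simp
  next
    case (step k F)
    obtain F0 F1 :: "real poly" where F0: "2 * degree F0 \<le> degree F"
      and F: "\<And>x. poly F x = poly F0 (2 * x\<^sup>2 - 1) + x * poly F1 (2 * x\<^sup>2 - 1)"
      using poly_even_odd_split[of F] by auto
    have "n - k = Suc (n - Suc k)" using step.hyps by simp
    then have deg: "degree F0 < 2 ^ (n - Suc k)" using F0 step.prems by simp
    have "(\<Sum>t\<in>X \<inter> {xs k..1}. poly F (poly (cheb2 k) t))
        = (\<Sum>t\<in>X \<inter> {xs (Suc k)..1}. poly F (poly (cheb2 k) t) + poly F (poly (cheb2 k) (S k t)))"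
      using step.hyps by (intro sum_admissible_fold[OF X]) auto
    also have "\<dots> = 2 * (\<Sum>t\<in>X \<inter> {xs (Suc k)..1}. poly F0 (poly (cheb2 (Suc k)) t))"
      unfolding sum_distrib_left by (intro sum.cong refl poly_cheb2_fold[OF F]) simp
    finally show ?case
      using step.IH[OF deg] integral_poly_cheb2_fold[OF \<rho> _ F, of k] step.hyps
      by (simp del: cheb2.simps)
  qed
  have "X \<inter> {xs 0..1} = X"
    using X by (auto simp: admissible_def)
  then have "2 ^ (n - 1) * (LINT x:{-1<..<1}|lebesgue. poly P x * \<rho> x)
      = (\<Sum>t\<in>X. poly P t)"
    using fold[of 0 P] P by simp
  then show "(LINT x:{-1<..<1}|lebesgue. poly P x * \<rho> x)
      = 1 / real (card X) * (\<Sum>t\<in>X. poly P t)"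
    by (simp add: card field_simps)
qed

section \<open>An admissible set with largest point \<open>xs n\<close>\<close>

text \<open>The witness consists of the zeros of \<open>cheb2 (n - 1)\<close>, with angles the odd multiples of
  \<open>pi / 2 ^ n\<close>.\<close>

lemma ex_admissible:
  assumes n: "n \<ge> 1"
  obtains X where "admissible n X" "Max X = xs n"
proof
  define c where "c i = cos (real i * pi / 2 ^ n)" for i
  define I where "I = {i :: nat. odd i \<and> i < 2 ^ n}"
  have range: "0 \<le> real i * pi / 2 ^ n \<and> real i * pi / 2 ^ n \<le> pi" if "i \<in> I" for i
  proof -
    have "real i \<le> 2 ^ n" using that by (simp add: I_def)
    then show ?thesis by (simp add: field_simps)
  qed
  have scale: "real i * pi / 2 ^ n \<le> pi / 2 ^ j \<longleftrightarrow> i \<le> 2 ^ (n - j)"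
    "pi / 2 ^ j \<le> real i * pi / 2 ^ n \<longleftrightarrow> 2 ^ (n - j) \<le> i" if "j \<le> n" for i j
  proof -
    have "pi / 2 ^ j = real (2 ^ (n - j)) * pi / 2 ^ n"
      using that by (simp add: field_simps flip: power_add)
    then show "real i * pi / 2 ^ n \<le> pi / 2 ^ j \<longleftrightarrow> i \<le> 2 ^ (n - j)"
      "pi / 2 ^ j \<le> real i * pi / 2 ^ n \<longleftrightarrow> 2 ^ (n - j) \<le> i"
      by (simp_all only: divide_le_cancel mult_le_cancel_right) auto
  qed
  have ge: "xs j \<le> c i \<longleftrightarrow> i \<le> 2 ^ (n - j)" if "i \<in> I" "j \<le> n" for i j
    using range[OF that(1)] scale[OF that(2)] by (simp add: c_def xs_le_cos_iff)
  have le: "c i \<le> xs j \<longleftrightarrow> 2 ^ (n - j) \<le> i" if "i \<in> I" "j \<le> n" for i j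
    using range[OF that(1)] scale[OF that(2)] by (simp add: c_def cos_le_xs_iff)
  \<comment> \<open>The bound on \<open>i\<close> puts \<open>c i\<close> into the domain of
    \<open>S k\<close> and keeps the natural-number subtraction from truncating.\<close>
  have S_c: "S k (c i) = c (2 ^ (n - k) - i)" if "i \<in> I" "k < n" "i \<le> 2 ^ (n - Suc k)" for i k
  proof -
    have "i \<le> 2 ^ (n - k)"
      using that(3) by (rule order_trans) (simp add: power_increasing)
    then have "real (2 ^ (n - k) - i) * pi / 2 ^ n = pi / 2 ^ k - real i * pi / 2 ^ n"
      using that(2) by (simp add: of_nat_diff field_simps flip: power_add)
    then show ?thesis
      using range[OF that(1)] scale(1)[of "Suc k" i] that by (simp add: c_def S_cos)
  qed
  have c1: "c 1 = xs n" by (simp add: c_def xs_eq_cos)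
  have one: "xs n \<in> c ` I"
    unfolding c1[symmetric] using n one_less_power[of "2::nat" n] by (intro imageI) (simp add: I_def)
  have fin: "finite (c ` I)" by (simp add: I_def)
  have open_range: "c i \<in> {-1<..<1}" if "i \<in> I" for i
  proof -
    have "i \<noteq> 0" "i < 2 ^ n" using that by (auto simp: I_def intro: ccontr)
    then have "0 < real i * pi / 2 ^ n" "real i * pi / 2 ^ n < pi"
      by (simp_all add: field_simps)
    then show ?thesis
      using cos_monotone_0_pi[of 0 "real i * pi / 2 ^ n"] cos_monotone_0_pi[of "real i * pi / 2 ^ n" pi]
      by (simp add: c_def)
  qed
  show "admissible n (c ` I)"
    unfolding admissible_def
  proof (intro conjI allI impI)
    show "c ` I \<inter> {xs n..1} \<noteq> {}"
      using one xs_less_1[of n] by force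
  next
    fix k assume k: "k < n"
    \<comment> \<open>As \<open>k < n\<close>, the number \<open>2 ^ (n - k)\<close> is even, so
      reflecting an index in it preserves oddness.\<close>
    have pow: "(2::nat) ^ (n - k) = 2 * 2 ^ (n - Suc k)"
      using k by (simp flip: power_Suc add: Suc_diff_Suc)
    have pow_le: "(2::nat) ^ (n - k) \<le> 2 ^ n" by (simp add: power_increasing)
    show "S k ` (c ` I \<inter> {xs (Suc k)..1}) = c ` I \<inter> {xs k..xs (Suc k)}"
    proof (intro equalityI subsetI)
      fix z assume "z \<in> S k ` (c ` I \<inter> {xs (Suc k)..1})"
      then obtain i where i: "i \<in> I" "i \<le> 2 ^ (n - Suc k)" "z = S k (c i)"
        using ge k by auto
      define i' where "i' = 2 ^ (n - k) - i"
      have "odd i" using i by (simp add: I_def)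
      then have "odd i'" "i > 0" using i(2) pow by (auto simp: i'_def intro: odd_pos)
      then have i': "i' \<in> I" "2 ^ (n - Suc k) \<le> i'" "i' \<le> 2 ^ (n - k)"
        using i(2) pow pow_le by (auto simp: I_def i'_def)
      moreover have "z = c i'" using i k by (simp add: S_c i'_def)
      ultimately show "z \<in> c ` I \<inter> {xs k..xs (Suc k)}"
        using k by (auto simp: ge le)
    next
      fix z assume "z \<in> c ` I \<inter> {xs k..xs (Suc k)}"
      then obtain i where i: "i \<in> I" "2 ^ (n - Suc k) \<le> i" "i \<le> 2 ^ (n - k)" "z = c i"
        using ge le k by auto
      define i' where "i' = 2 ^ (n - k) - i"
      have "odd i" using i by (simp add: I_def)
      moreover have "i \<noteq> 2 ^ (n - k)" using \<open>odd i\<close> pow by auto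
      ultimately have "odd i'" "i > 0" using i(2,3) pow by (auto simp: i'_def intro: odd_pos)
      then have i': "i' \<in> I" "i' \<le> 2 ^ (n - Suc k)"
        using i(2,3) pow pow_le by (auto simp: I_def i'_def)
      moreover have "z = S k (c i')" using i' i k by (simp add: S_c i'_def)
      moreover have "c i' \<le> 1" by (simp add: c_def)
      ultimately show "z \<in> S k ` (c ` I \<inter> {xs (Suc k)..1})"
        using k by (auto simp: ge)
    qed
  qed (use fin open_range in auto)
  show "Max (c ` I) = xs n"
  proof (rule Max_eqI[OF fin])
    fix z assume "z \<in> c ` I"
    then obtain i where "i \<in> I" "z = c i" by blast
    moreover from this have "1 \<le> i" by (auto simp: I_def intro: Suc_leI odd_pos)
    ultimately show "z \<le> xs n" by (simp add: le)
  qed (fact one)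
qed

section \<open>Upper bound for the degree of exactness\<close>

text \<open>If \<open>2 * m \<le> d\<close>, the squared node polynomial \<open>Q\<close> has
  integral 0 against \<open>\<rho>\<close>. Being nonnegative, \<open>Q * \<rho>\<close> then
  vanishes almost everywhere; off the finitely many nodes \<open>Q\<close> is nonzero, so
  \<open>\<rho>\<close> vanishes almost everywhere too, against its nonzero mass.\<close>

lemma quad_exact_bound:
  assumes nonneg: "\<And>x. x \<in> {-1<..<1} \<Longrightarrow> 0 \<le> \<rho> x"
    and int: "set_integrable lebesgue {-1<..<1} \<rho>"
    and mass: "(LINT x:{-1<..<1}|lebesgue. \<rho> x) \<noteq> 0"
    and exact: "quad_exact m \<rho> d"
  shows "d < 2 * m"
proof (rule ccontr)
  assume "\<not> d < 2 * m"
  obtain y where quad: "\<And>P :: real poly. degree P \<le> d \<Longrightarrow>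
      (LINT x:{-1<..<1}|lebesgue. poly P x * \<rho> x) = 1 / real m * (\<Sum>k=1..m. poly P (y k))"
    using exact unfolding quad_exact_def by blast
  define Q where "Q = (\<Prod>k=1..m. [:- y k, 1:]) ^ 2"
  have "degree (\<Prod>k=1..m. [:- y k, 1:]) = m"
    by (subst degree_prod_eq_sum_degree) auto
  then have "degree Q = 2 * m"
    unfolding Q_def by (subst degree_power_eq) (auto simp: prod_zero_iff)
  moreover have poly_Q: "poly Q x = (\<Prod>k=1..m. x - y k) ^ 2" for x
    by (simp add: Q_def poly_prod)
  moreover have "(\<Prod>j=1..m. y k - y j) = 0" if "k \<in> {1..m}" for k
    using that by (intro prod_zero) auto
  ultimately have 0: "(LINT x:{-1<..<1}|lebesgue. poly Q x * \<rho> x) = 0"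
    using quad[of Q] \<open>\<not> d < 2 * m\<close> by (auto simp: poly_Q intro!: sum.neutral)
  let ?f = "\<lambda>x. indicator {-1<..<1} x *\<^sub>R (poly Q x * \<rho> x)"
  have "(\<lambda>x. poly Q x * \<rho> x) absolutely_integrable_on {-1<..<1}"
  proof (rule absolutely_integrable_bounded_measurable_product_real[OF _ _ _ int])
    show "poly Q \<in> borel_measurable (lebesgue_on {-1<..<1})"
      by (intro continuous_imp_measurable_on_sets_lebesgue continuous_intros) auto
    have "bounded (poly Q ` {-1..1})"
      by (intro compact_imp_bounded compact_continuous_image continuous_intros) auto
    then show "bounded (poly Q ` {-1<..<1})"
      by (rule bounded_subset) auto
  qed auto
  then have "integrable lebesgue ?f" by (simp add: set_integrable_def)
  moreover have "AE x in lebesgue. 0 \<le> ?f x"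
    using nonneg by (intro AE_I2) (auto simp: indicator_def poly_Q)
  ultimately have "AE x in lebesgue. ?f x = 0"
    using 0 integral_nonneg_eq_0_iff_AE[of lebesgue ?f] by (simp add: set_lebesgue_integral_def)
  moreover have "AE x in lebesgue. x \<notin> y ` {1..m}"
    by (intro AE_completion AE_not_in countable_imp_null_set_lborel countable_finite) auto
  ultimately have "AE x in lebesgue. indicator {-1<..<1} x *\<^sub>R \<rho> x = 0"
    by eventually_elim (auto simp: poly_Q indicator_def)
  then have "(LINT x:{-1<..<1}|lebesgue. \<rho> x) = 0"
    unfolding set_lebesgue_integral_def by (rule integral_eq_zero_AE)
  with mass show False by simp
qed

theorem mainTheorem2:
  fixes n :: nat and \<rho> :: "real \<Rightarrow> real"
  assumes "n \<ge> 1" and "\<rho> \<in> W n"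
  shows "(\<forall>X. admissible n X \<longrightarrow> card X \<ge> 2 ^ (n - 1)) \<and>
         (\<forall>X. admissible n X \<and> Max X = xs n \<longrightarrow>
            card X = 2 ^ (n - 1) \<and>
            (\<forall>P :: real poly. degree P \<le> 2 ^ n - 1 \<longrightarrow>
               (LINT x:{-1<..<1}|lebesgue. poly P x * \<rho> x) =
                 1 / real (card X) * (\<Sum>t\<in>X. poly P t))) \<and>
         (\<forall>m. m = 2 ^ (n - 1) \<longrightarrow> M m \<rho> = 2 * m - 1)"
proof (intro conjI allI impI)
  fix X assume X: "admissible n X"
  have "card (X \<inter> {xs (n - 1)..1}) \<noteq> 0"
    using admissible_last_nonempty[OF X assms(1)] X by (simp add: admissible_def)
  then show "card X \<ge> 2 ^ (n - 1)"
    using card_admissible[OF X assms(1)] by simp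
next
  fix X assume "admissible n X \<and> Max X = xs n"
  \<comment> \<open>The zero polynomial fills the place of \<open>P\<close>, whose degree bound the
    lemma assumes for both of its conclusions.\<close>
  then show "card X = 2 ^ (n - 1)"
    using quadrature_admissible(1)[OF _ assms(1) _ assms(2), of X 0] by simp
next
  fix X and P :: "real poly"
  assume "admissible n X \<and> Max X = xs n" "degree P \<le> 2 ^ n - 1"
  moreover from this(2) have "degree P < 2 ^ n"
    by (simp add: le_less_trans)
  ultimately show "(LINT x:{-1<..<1}|lebesgue. poly P x * \<rho> x)
      = 1 / real (card X) * (\<Sum>t\<in>X. poly P t)"
    using quadrature_admissible(2)[OF _ assms(1) _ assms(2), of X P] by simp
next
  fix m :: nat assume m: "m = 2 ^ (n - 1)"
  \<comment> \<open>The claims about admissible sets are conditional; attaining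
    \<open>2 * m - 1\<close> requires that such a set exists.\<close>
  obtain X where X: "admissible n X" "Max X = xs n"
    using assms(1) by (rule ex_admissible)
  have card: "card X = m"
    using quadrature_admissible(1)[OF X(1) assms(1) X(2) assms(2), of 0] m by simp
  have "finite X" and sub: "X \<subseteq> {-1<..<1}"
    using X(1) by (auto simp: admissible_def)
  then obtain y where y: "bij_betw y {1..m} X"
    using ex_bij_betw_nat_finite_1[of X] card by blast
  \<comment> \<open>Hence degree at most \<open>2 * m - 1\<close> means degree below
    \<open>2 ^ n\<close>, the range of the quadrature formula.\<close>
  have m2: "2 * m = 2 ^ n"
    using assms(1) unfolding m by (cases n) simp_all
  have "quad_exact m \<rho> (2 * m - 1)"
    unfolding quad_exact_def
  proof (intro exI conjI allI impI)
    show "y ` {1..m} \<subseteq> {-1..1}"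
      using y sub by (auto simp: bij_betw_def)
    show "inj_on y {1..m}"
      using y by (rule bij_betw_imp_inj_on)
    fix P :: "real poly" assume "degree P \<le> 2 * m - 1"
    then have "degree P < 2 ^ n"
      unfolding m2 by (simp add: le_less_trans)
    then show "(LINT x:{-1<..<1}|lebesgue. poly P x * \<rho> x)
        = 1 / real m * (\<Sum>k=1..m. poly P (y k))"
      using quadrature_admissible(2)[OF X(1) assms(1) X(2) assms(2)] card
        sum.reindex_bij_betw[OF y, of "poly P"] by simp
  qed
  moreover have "d \<le> 2 * m - 1" if "quad_exact m \<rho> d" for d
    using quad_exact_bound[of \<rho> m d] that assms(2) unfolding W_def by auto
  ultimately show "M m \<rho> = 2 * m - 1"
    unfolding M_def by (rule Greatest_equality)
qed

end
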